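(* Let $(A,\circ)$ be an anti-pre-Lie algebra with sub-adjacent Lie algebra $(A,[-,-])$, $[x,y]=x\circ y-y\circ x$. Then there exists a nondegenerate bilinear form $\mathcal B$ on $A$ which is invariant on $(A,\circ)$, i.e. $\mathcal B(x\circ y,z)=\mathcal B(y,[x,z])$ for all $x,y,z\in A$, if and only if the representations $(-\mathcal L_\circ,A)$ and $(\mathrm{ad}^*,A^* )$ of the Lie algebra $(A,[-,-])$ are equivalent.
   Context: All vector spaces are finite-dimensional over a field $\mathbb F$ of characteristic $0$. An anti-pre-Lie algebra is a vector space $A$ with a bilinear operation $\circ$ such that, writing $[x,y]=x\circ y-y\circ x$, for all $x,y,z\in A$: (i) $x\circ(y\circ z)-y\circ(x\circ z)=[y,x]\circ z$, and (ii) $[x,y]\circ z+[y,z]\circ x+[z,x]\circ y=0$; then $(A,[-,-])$ is a Lie algebra. $\mathcal L_\circ(x)y=x\circ y$; $(-\mathcal L_\circ,A)$ is a representation of $(A,[-,-])$. $\mathrm{ad}^*$ is the coadjoint representation: $\langle \mathrm{ad}^*(x)a^*,y\rangle=-\langle a^*,[x,y]\rangle$. Two representations $(\rho_1,V_1),(\rho_2,V_2)$ are equivalent if there is a linear isomorphism $\varphi:V_1\to V_2$ with $\varphi(\rho_1(x)v)=\rho_2(x)\varphi(v)$. *)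

theory Defs
  imports "HOL-Analysis.Analysis"
begin

text \<open>A finite-dimensional vector space over a field of characteristic 0 is modelled
  as 'k^'n with 'n a finite index type; scalar multiplication is (*s).\<close>

type_synonym ('k, 'n) alg_op = "'k^'n \<Rightarrow> 'k^'n \<Rightarrow> 'k^'n"

definition bilinear_op :: "('k::field, 'n::finite) alg_op \<Rightarrow> bool" where
  "bilinear_op m \<longleftrightarrow>
     (\<forall>x. Vector_Spaces.linear (*s) (*s) (m x)) \<and>
     (\<forall>y. Vector_Spaces.linear (*s) (*s) (\<lambda>x. m x y))"

definition commutator :: "('k::field, 'n::finite) alg_op \<Rightarrow> 'k^'n \<Rightarrow> 'k^'n \<Rightarrow> 'k^'n" where
  "commutator m x y = m x y - m y x"

definition anti_pre_Lie :: "('k::field, 'n::finite) alg_op \<Rightarrow> bool" where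
  "anti_pre_Lie m \<longleftrightarrow> bilinear_op m \<and>
     (\<forall>x y z. m x (m y z) - m y (m x z) = m (commutator m y x) z) \<and>
     (\<forall>x y z. m (commutator m x y) z + m (commutator m y z) x + m (commutator m z x) y = 0)"

definition bilinear_form :: "('k::field^'n::finite \<Rightarrow> 'k^'n \<Rightarrow> 'k) \<Rightarrow> bool" where
  "bilinear_form B \<longleftrightarrow>
     (\<forall>x. Vector_Spaces.linear (*s) (*) (B x)) \<and>
     (\<forall>y. Vector_Spaces.linear (*s) (*) (\<lambda>x. B x y))"

definition nondegenerate :: "('k::field^'n::finite \<Rightarrow> 'k^'n \<Rightarrow> 'k) \<Rightarrow> bool" where
  "nondegenerate B \<longleftrightarrow>
     (\<forall>x. (\<forall>y. B x y = 0) \<longrightarrow> x = 0) \<and> (\<forall>y. (\<forall>x. B x y = 0) \<longrightarrow> y = 0)"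

text \<open>Invariance on (A, o): B(x o y, z) = B(y, [x,z]).\<close>
definition invariant_form :: "('k::field, 'n::finite) alg_op \<Rightarrow> ('k^'n \<Rightarrow> 'k^'n \<Rightarrow> 'k) \<Rightarrow> bool" where
  "invariant_form m B \<longleftrightarrow> (\<forall>x y z. B (m x y) z = B y (commutator m x z))"

text \<open>The dual space A* = linear functionals on A.\<close>
definition dual_space :: "('k::field^'n::finite \<Rightarrow> 'k) set" where
  "dual_space = {f. Vector_Spaces.linear (*s) (*) f}"

text \<open>Coadjoint representation of the Lie algebra (A,[-,-]):
  <ad*(x) a, y> = - <a, [x,y]>.\<close>
definition coad :: "('k::field, 'n::finite) alg_op \<Rightarrow> 'k^'n \<Rightarrow> ('k^'n \<Rightarrow> 'k) \<Rightarrow> ('k^'n \<Rightarrow> 'k)" where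
  "coad m x a = (\<lambda>y. - a (commutator m x y))"

text \<open>Representation (-L_o, A): x acts by v \<mapsto> -(x o v).\<close>
definition neg_left_mult :: "('k::field, 'n::finite) alg_op \<Rightarrow> 'k^'n \<Rightarrow> 'k^'n \<Rightarrow> 'k^'n" where
  "neg_left_mult m x v = - m x v"

text \<open>Equivalence of (-L_o, A) and (ad*, A*): a linear isomorphism phi : A \<rightarrow> A*
  intertwining the actions.\<close>
definition equiv_negL_coad :: "('k::field, 'n::finite) alg_op \<Rightarrow> bool" where
  "equiv_negL_coad m \<longleftrightarrow> (\<exists>\<phi> :: 'k^'n \<Rightarrow> ('k^'n \<Rightarrow> 'k).
     (\<forall>u v y. \<phi> (u + v) y = \<phi> u y + \<phi> v y) \<and>
     (\<forall>c u y. \<phi> (c *s u) y = c * \<phi> u y) \<and>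
     bij_betw \<phi> UNIV dual_space \<and>
     (\<forall>x v. \<phi> (neg_left_mult m x v) = coad m x (\<phi> v)))"

end

theory Submission
  imports Defs
begin

text \<open>A bilinear form \<open>B\<close> is the same thing as the linear map \<open>v \<mapsto> B v\<close> from \<open>A\<close> to
  the space of functionals \<open>A\<^sup>*\<close>. Under this correspondence invariance
  \<open>B (x \<circ> y) z = B y [x, z]\<close> is literally the intertwining identity
  \<open>B (-x \<circ> y) = ad\<^sup>*(x) (B y)\<close>, and nondegeneracy of \<open>B\<close> is bijectivity of \<open>v \<mapsto> B v\<close> onto
  \<open>A\<^sup>*\<close>: injectivity is left nondegeneracy, and since \<open>dim A\<^sup>* = dim A\<close> an injective linear
  map is already onto.\<close>

lemma linear_vec_iff:
  "Vector_Spaces.linear (*s) (*s) (f :: 'k::field^'n::finite \<Rightarrow> 'k^'m::finite) \<longleftrightarrow>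
   (\<forall>x y. f (x + y) = f x + f y) \<and> (\<forall>c x. f (c *s x) = c *s f x)"
  by (simp add: Vector_Spaces.linear_iff vec.vector_space_axioms)

lemma linear_functional_iff:
  "Vector_Spaces.linear (*s) (*) (f :: 'k::field^'n::finite \<Rightarrow> 'k) \<longleftrightarrow>
   (\<forall>x y. f (x + y) = f x + f y) \<and> (\<forall>c x. f (c *s x) = c * f x)"
  by (simp add: Vector_Spaces.linear_iff vec.vector_space_axioms
      vector_space_over_itself.vector_space_axioms)

lemma linear_functional_basis_expansion:
  assumes "Vector_Spaces.linear (*s) (*) (f :: 'k::field^'n::finite \<Rightarrow> 'k)"
  shows "f y = (\<Sum>i\<in>UNIV. y$i * f (axis i 1))"
proof -
  interpret f: Vector_Spaces.linear "(*s)" "(*)" f by fact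
  have "f y = f (\<Sum>i\<in>UNIV. y$i *s axis i 1)" by (simp add: basis_expansion)
  also have "\<dots> = (\<Sum>i\<in>UNIV. y$i * f (axis i 1))" by (simp add: f.sum f.scale)
  finally show ?thesis .
qed

lemma linear_functional_eq_stdbasis:
  fixes f g :: "'k::field^'n::finite \<Rightarrow> 'k"
  assumes "Vector_Spaces.linear (*s) (*) f" and "Vector_Spaces.linear (*s) (*) g"
    and "\<And>i. f (axis i 1) = g (axis i 1)"
  shows "f = g"
proof
  fix y
  have "f y = (\<Sum>i\<in>UNIV. y$i * f (axis i 1))"
    by (rule linear_functional_basis_expansion[OF assms(1)])
  also have "\<dots> = (\<Sum>i\<in>UNIV. y$i * g (axis i 1))"
    by (simp add: assms(3))
  also have "\<dots> = g y"
    by (rule linear_functional_basis_expansion[OF assms(2), symmetric])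
  finally show "f y = g y" .
qed

lemma bilinear_form_iff_dual_space_valued:
  "bilinear_form B \<longleftrightarrow>
     (\<forall>u v y. B (u + v) y = B u y + B v y) \<and> (\<forall>c u y. B (c *s u) y = c * B u y) \<and>
     range B \<subseteq> dual_space"
  by (auto simp: bilinear_form_def dual_space_def linear_functional_iff image_subset_iff)

lemma invariant_form_iff_intertwining:
  assumes "\<And>c u y. B (c *s u) y = c * B u y"
  shows "invariant_form m B \<longleftrightarrow> (\<forall>x v. B (neg_left_mult m x v) = coad m x (B v))"
proof -
  have "B (neg_left_mult m x v) y = - B (m x v) y" for x v y
    using assms[of "-1" "m x v" y] by (simp add: neg_left_mult_def)
  then show ?thesis
    by (simp add: invariant_form_def coad_def fun_eq_iff)
qed

lemma nondegenerate_imp_bij_betw_dual_space: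
  fixes B :: "'k::field^'n::finite \<Rightarrow> 'k^'n \<Rightarrow> 'k"
  assumes bf: "bilinear_form B" and nd: "nondegenerate B"
  shows "bij_betw B UNIV dual_space"
proof -
  have left: "Vector_Spaces.linear (*s) (*) (\<lambda>u. B u y)" for y
    using bf by (simp add: bilinear_form_def)
  have right: "Vector_Spaces.linear (*s) (*) (B u)" for u
    using bf by (simp add: bilinear_form_def)
  have inj: "inj B"
  proof (rule injI)
    fix u v assume "B u = B v"
    have "B (u - v) y = 0" for y
    proof -
      interpret Vector_Spaces.linear "(*s)" "(*)" "\<lambda>u. B u y" by (rule left)
      show ?thesis using \<open>B u = B v\<close> diff[of u v] by simp
    qed
    then have "u - v = 0" using nd unfolding nondegenerate_def by blast
    then show "u = v" by simp
  qed
  \<comment> \<open>Evaluation on the standard basis identifies \<open>A\<^sup>*\<close> with \<open>A\<close>, so the dimension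
    count becomes injective-implies-surjective for an endomorphism.\<close>
  define coords :: "'k^'n \<Rightarrow> 'k^'n" where "coords v = (\<chi> i. B v (axis i 1))" for v
  have "Vector_Spaces.linear (*s) (*s) coords"
    using left by (simp add: linear_vec_iff linear_functional_iff coords_def vec_eq_iff)
  moreover have "inj coords"
    by (rule injI, rule injD[OF inj], rule linear_functional_eq_stdbasis[OF right right])
      (simp add: coords_def vec_eq_iff)
  ultimately have "surj coords" by (rule vec.linear_inj_imp_surj)
  have "f \<in> range B" if "f \<in> dual_space" for f
  proof -
    obtain v where "coords v = (\<chi> i. f (axis i 1))"
      using \<open>surj coords\<close> by (metis surjD)
    then have "B v = f"
      using that by (intro linear_functional_eq_stdbasis[OF right])
        (simp_all add: dual_space_def coords_def vec_eq_iff)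
    then show ?thesis by blast
  qed
  moreover have "range B \<subseteq> dual_space"
    using right by (auto simp: dual_space_def)
  ultimately show ?thesis
    unfolding bij_betw_def using inj by blast
qed

lemma bij_betw_dual_space_imp_nondegenerate:
  fixes B :: "'k::field^'n::finite \<Rightarrow> 'k^'n \<Rightarrow> 'k"
  assumes bf: "bilinear_form B" and bij: "bij_betw B UNIV dual_space"
  shows "nondegenerate B"
  unfolding nondegenerate_def
proof (intro conjI allI impI)
  fix u assume "\<forall>y. B u y = 0"
  moreover have "B 0 y = 0" for y
    using bf unfolding bilinear_form_def linear_functional_iff
    by (metis vector_smult_lzero mult_zero_left)
  ultimately have "B u = B 0" by auto
  with bij show "u = 0" by (simp add: bij_betw_def inj_eq)
next
  fix y assume zero: "\<forall>u. B u y = 0"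
  have "y$i = 0" for i
  proof -
    have "(\<lambda>z. z$i) \<in> dual_space" by (simp add: dual_space_def linear_functional_iff)
    then obtain u where "B u = (\<lambda>z. z$i)"
      using bij by (metis bij_betw_def imageE)
    then have "y$i = B u y" by simp
    with zero show ?thesis by simp
  qed
  then show "y = 0" by (simp add: vec_eq_iff)
qed

lemma invariant_nondegenerate_iff_intertwining_isomorphism:
  "bilinear_form B \<and> nondegenerate B \<and> invariant_form m B \<longleftrightarrow>
     (\<forall>u v y. B (u + v) y = B u y + B v y) \<and> (\<forall>c u y. B (c *s u) y = c * B u y) \<and>
     bij_betw B UNIV dual_space \<and> (\<forall>x v. B (neg_left_mult m x v) = coad m x (B v))"
proof
  assume "bilinear_form B \<and> nondegenerate B \<and> invariant_form m B"
  then have bf: "bilinear_form B" and nd: "nondegenerate B" and inv: "invariant_form m B"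
    by blast+
  from bf have add: "\<forall>u v y. B (u + v) y = B u y + B v y"
    and sc: "\<forall>c u y. B (c *s u) y = c * B u y"
    by (simp_all add: bilinear_form_iff_dual_space_valued)
  show "(\<forall>u v y. B (u + v) y = B u y + B v y) \<and> (\<forall>c u y. B (c *s u) y = c * B u y) \<and>
     bij_betw B UNIV dual_space \<and> (\<forall>x v. B (neg_left_mult m x v) = coad m x (B v))"
    using add sc nondegenerate_imp_bij_betw_dual_space[OF bf nd]
      inv[unfolded invariant_form_iff_intertwining[OF sc[rule_format]]]
    by blast
next
  assume "(\<forall>u v y. B (u + v) y = B u y + B v y) \<and> (\<forall>c u y. B (c *s u) y = c * B u y) \<and>
     bij_betw B UNIV dual_space \<and> (\<forall>x v. B (neg_left_mult m x v) = coad m x (B v))"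
  then have add: "\<forall>u v y. B (u + v) y = B u y + B v y"
    and sc: "\<forall>c u y. B (c *s u) y = c * B u y"
    and bij: "bij_betw B UNIV dual_space"
    and intertwining: "\<forall>x v. B (neg_left_mult m x v) = coad m x (B v)"
    by blast+
  have bf: "bilinear_form B"
    using add sc bij_betw_imp_surj_on[OF bij] by (simp add: bilinear_form_iff_dual_space_valued)
  moreover have "invariant_form m B"
    using intertwining by (simp add: invariant_form_iff_intertwining[OF sc[rule_format]])
  ultimately show "bilinear_form B \<and> nondegenerate B \<and> invariant_form m B"
    using bij_betw_dual_space_imp_nondegenerate[OF bf bij] by blast
qed

theorem proposition2p24:
  fixes m :: "('k::field_char_0, 'n::finite) alg_op"
  assumes "anti_pre_Lie m"
  shows "(\<exists>B. bilinear_form B \<and> nondegenerate B \<and> invariant_form m B)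
         \<longleftrightarrow> equiv_negL_coad m"
  unfolding equiv_negL_coad_def invariant_nondegenerate_iff_intertwining_isomorphism ..

end
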